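(* Let $d \geq 1$, let $X \subset \mathbb{Z}^d$ be a non-empty finite fully convex set, and let $z \in X$. Then $z$ is peelable in $X$ if and only if $X \setminus \{z\}$ is fully convex.
   Context: Cells and full convexity. An open cell of the cubical complex of $\mathbb{R}^d$ induced by $\mathbb{Z}^d$ is a product $c = c_1 \times \cdots \times c_d$ where each $c_j$ is either a singleton $\{a\}$ or an open interval $(a,a+1)$ with $a \in \mathbb{Z}$; it is a $k$-cell if exactly $k$ of the factors are open intervals. For $Y \subset \mathbb{R}^d$ and $0 \le k \le d$, let $\bar{\mathcal{C}}^d_k[Y]$ be the set of $k$-cells whose topological closure in $\mathbb{R}^d$ meets $Y$. Let $\mathrm{CvxH}(Y)$ be the convex hull of $Y$ in $\mathbb{R}^d$. A set $X \subset \mathbb{Z}^d$ is fully convex if $\bar{\mathcal{C}}^d_k[X] = \bar{\mathcal{C}}^d_k[\mathrm{CvxH}(X)]$ for all $k$ with $0 \le k \le d$ (in particular, the empty set is fully convex). Vertices and projections. $\mathrm{Vtcs}(P)$ denotes the set of extreme points (vertices) of a polytope $P$. Let $I_d=\{1,\ldots,d\}$, let $\mathbf{e}_i$ be the $i$-th canonical basis vector, and for $i \in I_d$ let $\pi_i : \mathbb{R}^d \to \mathbb{R}^{d-1}$ be the map that omits the $i$-th coordinate. It is known that if $d\ge 2$ and $X$ is fully convex in $\mathbb{Z}^d$ then $\pi_i(X)$ is fully convex in $\mathbb{Z}^{d-1}$. Peelability (defined by recursion on $d$). For a fully convex set $X \subset \mathbb{Z}^d$ and $z \in X$, $z$ is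 peelable in $X$ when $z \in \mathrm{Vtcs}(\mathrm{CvxH}(X))$ and, when $d \geq 2$, for every $i \in I_d$, either (i) $z - \mathbf{e}_i \in X$ or $z + \mathbf{e}_i \in X$, or (ii) $\pi_i(z)$ is peelable in $\pi_i(X) \subset \mathbb{Z}^{d-1}$. (So when $d=1$, $z$ is peelable iff it is a vertex of $\mathrm{CvxH}(X)$.) *)

theory Defs
  imports "HOL-Analysis.Analysis"
begin

text \<open>The dimension is \<open>d = CARD('n)\<close>; index types are non-empty, so \<open>d \<ge> 1\<close>.\<close>

definition int_lattice :: "(real ^ 'n) set" where
  "int_lattice = {x. \<forall>j. x $ j \<in> \<int>}"

definition int_point :: "real set \<Rightarrow> bool" where
  "int_point S \<longleftrightarrow> (\<exists>a::int. S = {real_of_int a})"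

definition unit_interval :: "real set \<Rightarrow> bool" where
  "unit_interval S \<longleftrightarrow> (\<exists>a::int. S = {real_of_int a <..< real_of_int a + 1})"

definition cells :: "nat \<Rightarrow> (real ^ 'n) set set" where
  "cells k = {{x. \<forall>j. x $ j \<in> F j} | F.
     (\<forall>j. int_point (F j) \<or> unit_interval (F j)) \<and> card {j. unit_interval (F j)} = k}"

definition touching_cells :: "nat \<Rightarrow> (real ^ 'n) set \<Rightarrow> (real ^ 'n) set set" where
  "touching_cells k Y = {c \<in> cells k. closure c \<inter> Y \<noteq> {}}"

definition fully_convex :: "(real ^ 'n) set \<Rightarrow> bool" where
  "fully_convex X \<longleftrightarrow> X \<subseteq> int_lattice \<and>
     (\<forall>k \<le> CARD('n). touching_cells k X = touching_cells k (convex hull X))"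

text \<open>
  The recursion for peelability lowers the dimension, which is part of the type here.
  For a set \<open>J\<close> of coordinates, the space of vectors indexed by \<open>J\<close> is therefore identified
  with the subspace of vectors that vanish outside \<open>J\<close>. Omitting the coordinate \<open>i\<close> sends this
  subspace to the one for \<open>J - {i}\<close>: the entry is set to 0 and \<open>i\<close> is removed from \<open>J\<close>.
  Extreme points of convex hulls are computed within a subspace exactly as in the whole space.
\<close>

definition omit_coord :: "'n \<Rightarrow> real ^ 'n \<Rightarrow> real ^ 'n" where
  "omit_coord i x = (\<chi> j. if j = i then 0 else x $ j)"

function peelable_on :: "'n::finite set \<Rightarrow> (real ^ 'n) set \<Rightarrow> real ^ 'n \<Rightarrow> bool" where
  "peelable_on J X z \<longleftrightarrow>
     z extreme_point_of (convex hull X) \<and>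
     (card J \<ge> 2 \<longrightarrow>
       (\<forall>i\<in>J. z - axis i 1 \<in> X \<or> z + axis i 1 \<in> X \<or>
          peelable_on (J - {i}) (omit_coord i ` X) (omit_coord i z)))"
  by pat_completeness auto
termination
  by (relation "Wellfounded.measure (\<lambda>(J, X, z). card J)") (auto intro: psubset_card_mono)

declare peelable_on.simps [simp del]

text \<open>
  The predicate is total in \<open>X\<close> and \<open>z\<close>; its intended domain is
  fully convex \<open>X\<close> with \<open>z \<in> X\<close>.
\<close>

definition peelable :: "(real ^ 'n) set \<Rightarrow> real ^ 'n \<Rightarrow> bool" where
  "peelable X z \<longleftrightarrow> peelable_on UNIV X z"

end

theory Submission
  imports Defs
begin

text \<open>
  A cell closure meeting a point \<open>y\<close> contains the smallest closed cell around \<open>y\<close>, whose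
  lattice points are exactly those at sup-distance less than 1 from \<open>y\<close>. Full convexity
  therefore says that every point of \<open>convex hull X\<close> can be rounded to a point of \<open>X\<close>; for the
  deletion of \<open>z\<close>, take a point \<open>y\<close> of \<open>convex hull (X - {z})\<close> that cannot be rounded to
  \<open>X - {z}\<close> and differs from \<open>z\<close> in as few coordinates as possible. If in each such coordinate
  \<open>i\<close> the neighbour of \<open>z\<close> on the side opposite to \<open>y\<close> is in \<open>X\<close>, then \<open>z\<close> is a convex combination
  of \<open>y\<close> and these neighbours, hence not a vertex. Otherwise the fibre of \<open>z\<close> in direction \<open>i\<close>
  is trivial, and the full convexity of the projection without \<open>z\<close> rounds \<open>y\<close>, up to the
  coordinate \<open>i\<close>, to some \<open>x \<in> X - {z}\<close>. Depending on the side on which \<open>x\<close> lies, either the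
  segment from \<open>z\<close> to \<open>x\<close> yields another rounding of \<open>y\<close>, or the segment from \<open>y\<close> to \<open>x\<close> contains
  a counterexample that differs from \<open>z\<close> in fewer coordinates.
\<close>

section \<open>Full convexity as a rounding property\<close>

definition near :: "real ^ 'n \<Rightarrow> real ^ 'n \<Rightarrow> bool" where
  "near x y \<longleftrightarrow> (\<forall>j. \<bar>x $ j - y $ j\<bar> < 1)"

definition rounds :: "(real ^ 'n) set \<Rightarrow> bool" where
  "rounds X \<longleftrightarrow> X \<subseteq> int_lattice \<and> (\<forall>y \<in> convex hull X. \<exists>x \<in> X. near x y)"

text \<open>Sequences converging in each factor assemble to one converging in the product. This lets
  closures of cells be tested one coordinate at a time.\<close>

lemma closure_vec_box:
  fixes F :: "'n::finite \<Rightarrow> real set"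
  shows "closure {x :: real ^ 'n. \<forall>j. x $ j \<in> F j} = {x. \<forall>j. x $ j \<in> closure (F j)}"
proof (rule closure_unique)
  show "{x :: real ^ 'n. \<forall>j. x $ j \<in> F j} \<subseteq> {x. \<forall>j. x $ j \<in> closure (F j)}"
    using closure_subset by blast
  show "closed {x :: real ^ 'n. \<forall>j. x $ j \<in> closure (F j)}"
    by (simp add: closed_vector_box)
  show "{x. \<forall>j. x $ j \<in> closure (F j)} \<subseteq> T"
    if T: "{x :: real ^ 'n. \<forall>j. x $ j \<in> F j} \<subseteq> T" "closed T" for T
  proof
    fix x :: "real ^ 'n" assume "x \<in> {x. \<forall>j. x $ j \<in> closure (F j)}"
    then have "\<forall>j. \<exists>f. (\<forall>n. f n \<in> F j) \<and> f \<longlonglongrightarrow> x $ j"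
      by (simp add: closure_sequential)
    then obtain f where f: "\<And>j n. f j n \<in> F j" "\<And>j. f j \<longlonglongrightarrow> x $ j"
      by metis
    have "(\<lambda>n. \<chi> j. f j n) \<longlonglongrightarrow> x"
      by (rule vec_tendstoI) (simp add: f)
    then show "x \<in> T"
      using T f(1) by (intro closed_sequentially[OF T(2) _ \<open>(\<lambda>n. \<chi> j. f j n) \<longlonglongrightarrow> x\<close>]) auto
  qed
qed

text \<open>Otherwise \<open>x\<close>, being an integer, would be at least 1 beyond an integer
  bound, hence at least 1 away from \<open>y\<close>. With \<open>l = u = y\<close> this forces
  \<open>x = y\<close>.\<close>

lemma int_near_imp_between:
  fixes x y l u :: real
  assumes "x \<in> \<int>" "l \<in> \<int>" "u \<in> \<int>" "\<bar>x - y\<bar> < 1" "l \<le> y" "y \<le> u"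
  shows "l \<le> x \<and> x \<le> u"
proof -
  obtain a b c where "x = of_int a" "l = of_int b" "u = of_int c"
    using assms(1-3) by (auto elim!: Ints_cases)
  with assms(4-6) have "b < a + 1" "a < c + 1"
    by linarith+
  then show ?thesis
    using \<open>x = _\<close> \<open>l = _\<close> \<open>u = _\<close> by simp
qed

text \<open>\<open>near\<close> is not transitive. Here \<open>w\<close> lies in the smallest closed
  cell around \<open>y\<close>, and rounding \<open>w\<close> does not leave that cell.\<close>

lemma near_trans_floor_ceiling:
  assumes "x \<in> int_lattice" "near x w"
    and "\<And>j. of_int \<lfloor>y $ j\<rfloor> \<le> w $ j \<and> w $ j \<le> of_int \<lceil>y $ j\<rceil>"
  shows "near x y"
  unfolding near_def
proof
  fix j
  have "of_int \<lfloor>y $ j\<rfloor> \<le> x $ j \<and> x $ j \<le> of_int \<lceil>y $ j\<rceil>"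
    using assms by (intro int_near_imp_between[of _ _ _ "w $ j"]) (auto simp: int_lattice_def near_def)
  then show "\<bar>x $ j - y $ j\<bar> < 1"
    by linarith
qed

lemma near_floor_ceiling:
  assumes "x \<in> int_lattice" "near x y"
  shows "of_int \<lfloor>y $ j\<rfloor> \<le> x $ j \<and> x $ j \<le> of_int \<lceil>y $ j\<rceil>"
  using assms
  by (intro int_near_imp_between[of _ _ _ "y $ j"]) (auto simp: int_lattice_def near_def)

lemma fully_convex_iff_rounds: "fully_convex X \<longleftrightarrow> rounds X"
proof
  assume fc: "fully_convex X"
  have X: "X \<subseteq> int_lattice"
    using fc by (simp add: fully_convex_def)
  have "\<exists>x \<in> X. near x y" if y: "y \<in> convex hull X" for y
  proof -
    \<comment> \<open>The factors of the open cell that contains \<open>y\<close>.\<close>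
    define F where "F j = (if y $ j \<in> \<int> then {y $ j}
      else {of_int \<lfloor>y $ j\<rfloor> <..< of_int \<lfloor>y $ j\<rfloor> + 1})" for j
    define k where "k = card {j. unit_interval (F j)}"
    define c where "c = {x :: real ^ 'a. \<forall>j. x $ j \<in> F j}"
    have floor_less: "of_int \<lfloor>y $ j\<rfloor> < y $ j" if "y $ j \<notin> \<int>" for j
      using that of_int_floor_le[of "y $ j"] Ints_of_int[of "\<lfloor>y $ j\<rfloor>"]
      by (metis order_le_less)
    have F: "int_point (F j) \<or> unit_interval (F j)" for j
      by (auto simp: F_def int_point_def unit_interval_def elim!: Ints_cases)
    have "c \<in> cells k"
      unfolding cells_def c_def k_def using F by blast
    moreover have "y $ j \<in> F j" for j
    proof (cases "y $ j \<in> \<int>")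
      case False
      then show ?thesis
        using floor_less by (simp add: F_def)
    qed (simp add: F_def)
    then have "y \<in> c"
      by (simp add: c_def)
    moreover have k: "k \<le> CARD('a)"
      unfolding k_def by (simp add: card_mono)
    ultimately have "c \<in> touching_cells k X"
      using fc y closure_subset[of c] unfolding fully_convex_def touching_cells_def by blast
    then obtain x where x: "x \<in> X" "x \<in> closure c"
      by (auto simp: touching_cells_def)
    have "\<bar>x $ j - y $ j\<bar> < 1" for j
    proof -
      have xj: "x $ j \<in> closure (F j)"
        using x(2) by (simp add: c_def closure_vec_box)
      show ?thesis
      proof (cases "y $ j \<in> \<int>")
        case True
        with xj show ?thesis by (simp add: F_def)
      next
        case False
        with xj have "of_int \<lfloor>y $ j\<rfloor> \<le> x $ j" "x $ j \<le> of_int \<lfloor>y $ j\<rfloor> + 1"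
          by (simp_all add: F_def)
        with floor_less[OF False] show ?thesis
          by linarith
      qed
    qed
    with x(1) show ?thesis by (auto simp: near_def)
  qed
  with X show "rounds X" by (simp add: rounds_def)
next
  assume r: "rounds X"
  then have X: "X \<subseteq> int_lattice"
    by (simp add: rounds_def)
  have "c \<in> touching_cells k X" if c: "c \<in> touching_cells k (convex hull X)" for c k
  proof -
    obtain F where F: "c = {x. \<forall>j. x $ j \<in> F j}" "\<And>j. int_point (F j) \<or> unit_interval (F j)"
      and ck: "c \<in> cells k"
      using c by (auto simp: touching_cells_def cells_def)
    obtain y where y: "y \<in> closure c" "y \<in> convex hull X"
      using c by (auto simp: touching_cells_def)
    obtain x where x: "x \<in> X" "near x y"
      using r y by (auto simp: rounds_def)
    have "x $ j \<in> closure (F j)" for j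
    proof -
      have yj: "y $ j \<in> closure (F j)"
        using y(1) by (simp add: F(1) closure_vec_box)
      \<comment> \<open>The closed factors have integer end points, so rounding a point cannot leave
        them.\<close>
      have "\<exists>a b :: int. closure (F j) = {of_int a .. of_int b}"
        using F(2)[of j] unfolding int_point_def unit_interval_def
      proof
        assume "\<exists>a. F j = {real_of_int a}"
        then obtain a where "F j = {real_of_int a}" ..
        then have "closure (F j) = {of_int a .. of_int a}" by simp
        then show ?thesis by blast
      next
        assume "\<exists>a. F j = {real_of_int a<..<real_of_int a + 1}"
        then obtain a where "F j = {real_of_int a<..<real_of_int a + 1}" ..
        then have "closure (F j) = {of_int a .. of_int (a + 1)}" by simp
        then show ?thesis by blast
      qed
      then obtain a b :: int where ab: "closure (F j) = {of_int a .. of_int b}" by blast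
      have "of_int a \<le> x $ j \<and> x $ j \<le> of_int b"
        using x X yj ab
        by (intro int_near_imp_between[of _ _ _ "y $ j"]) (auto simp: int_lattice_def near_def)
      then show ?thesis by (simp add: ab)
    qed
    then have "x \<in> closure c"
      by (simp add: F(1) closure_vec_box)
    with x ck show ?thesis by (auto simp: touching_cells_def)
  qed
  moreover have "touching_cells k X \<subseteq> touching_cells k (convex hull X)" for k
    unfolding touching_cells_def using hull_subset[of X convex] by blast
  ultimately show "fully_convex X"
    using X by (auto simp: fully_convex_def)
qed

lemma fully_convex_empty: "fully_convex {}"
  by (simp add: fully_convex_def)

section \<open>Projections along a coordinate and their fibres\<close>

lemma omit_coord_nth [simp]: "omit_coord i x $ j = (if j = i then 0 else x $ j)"
  by (simp add: omit_coord_def)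

lemma linear_omit_coord: "linear (omit_coord i)"
  by (rule linearI) (simp_all add: vec_eq_iff)

text \<open>Hulls commute with linear maps, so a point of the projected hull lifts to
  \<open>convex hull X\<close>. A rounding of the lift projects to a rounding of the point.\<close>

lemma fully_convex_omit_coord:
  assumes "fully_convex X"
  shows "fully_convex (omit_coord i ` X)"
proof -
  have r: "rounds X"
    using assms by (simp add: fully_convex_iff_rounds)
  have "omit_coord i ` X \<subseteq> int_lattice"
    using r by (auto simp: rounds_def int_lattice_def)
  moreover have "\<exists>x \<in> X. near (omit_coord i x) y"
    if "y \<in> convex hull (omit_coord i ` X)" for y
  proof -
    have "y \<in> omit_coord i ` (convex hull X)"
      using that unfolding convex_hull_linear_image[OF linear_omit_coord] .
    then obtain w where w: "w \<in> convex hull X" "y = omit_coord i w"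
      by blast
    obtain x where "x \<in> X" "near x w"
      using r w by (auto simp: rounds_def)
    then show ?thesis
      using w by (auto simp: near_def)
  qed
  ultimately show ?thesis
    by (simp add: fully_convex_iff_rounds rounds_def)
qed

lemma fully_convex_lattice_point:
  assumes "fully_convex X" "y \<in> convex hull X" "y \<in> int_lattice"
  shows "y \<in> X"
proof -
  obtain x where x: "x \<in> X" "near x y" "x \<in> int_lattice"
    using assms(1,2) unfolding fully_convex_iff_rounds rounds_def by blast
  have "y $ j \<le> x $ j \<and> x $ j \<le> y $ j" for j
    using assms(3) x
    by (intro int_near_imp_between[of _ _ _ "y $ j"]) (auto simp: int_lattice_def near_def)
  then have "x = y"
    by (simp add: vec_eq_iff order_antisym)
  with x show ?thesis by simp
qed

text \<open>The segment from \<open>z\<close> to a second point of the fibre passes through a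
  neighbour of \<open>z\<close>, a lattice point of the hull and hence a point of
  \<open>X\<close>.\<close>

lemma single_fibre:
  assumes "fully_convex X" "z \<in> X" "x \<in> X" "omit_coord i x = omit_coord i z"
    and "z - axis i 1 \<notin> X" "z + axis i 1 \<notin> X"
  shows "x = z"
proof (rule ccontr)
  assume "x \<noteq> z"
  have off: "x $ j = z $ j" if "j \<noteq> i" for j
    using arg_cong[OF assms(4), of "\<lambda>v. v $ j"] that by simp
  define m where "m = x $ i - z $ i"
  have xz: "x = z + m *\<^sub>R axis i 1"
    using off by (auto simp: vec_eq_iff m_def axis_def)
  have L: "x \<in> int_lattice" "z \<in> int_lattice"
    using assms by (auto simp: fully_convex_def)
  have "m \<noteq> 0"
    using xz \<open>x \<noteq> z\<close> by auto
  moreover have "m \<in> \<int>"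
    using L by (auto simp: m_def int_lattice_def)
  ultimately have m: "1 \<le> \<bar>m\<bar>"
    using Ints_nonzero_abs_ge1 by blast
  \<comment> \<open>The parameter at which the segment has moved exactly one unit away from
    \<open>z\<close>.\<close>
  define t where "t = 1 / \<bar>m\<bar>"
  have "(1 - t) *\<^sub>R z + t *\<^sub>R x \<in> convex hull X"
    using m assms hull_subset[of X convex]
    by (intro convexD_alt[OF convex_convex_hull]) (auto simp: t_def)
  moreover have "(1 - t) *\<^sub>R z + t *\<^sub>R x = z + sgn m *\<^sub>R axis i 1"
    using m by (auto simp: xz t_def sgn_if algebra_simps)
  ultimately have "z + sgn m *\<^sub>R axis i 1 \<in> convex hull X"
    by simp
  moreover have "z + sgn m *\<^sub>R axis i 1 \<in> int_lattice"
    using L by (auto simp: int_lattice_def axis_def sgn_if)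
  ultimately have "z + sgn m *\<^sub>R axis i 1 \<in> X"
    using fully_convex_lattice_point assms by blast
  then show False
    using assms m by (auto simp: sgn_if split: if_splits)
qed

lemma omit_coord_image_Diff:
  assumes "fully_convex X" "z \<in> X" "z - axis i 1 \<notin> X" "z + axis i 1 \<notin> X"
  shows "omit_coord i ` (X - {z}) = omit_coord i ` X - {omit_coord i z}"
proof -
  have "omit_coord i x \<noteq> omit_coord i z" if "x \<in> X - {z}" for x
    using single_fibre[OF assms(1,2) _ _ assms(3,4), of x] that by auto
  then show ?thesis
    by auto
qed

section \<open>Vertices and the deletion of a vertex\<close>

lemma extreme_point_iff_notin_hull_Diff:
  fixes X :: "'a::euclidean_space set"
  assumes "finite X" "z \<in> X"
  shows "z extreme_point_of (convex hull X) \<longleftrightarrow> z \<notin> convex hull (X - {z})"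
proof
  assume e: "z extreme_point_of (convex hull X)"
  show "z \<notin> convex hull (X - {z})"
  proof
    assume "z \<in> convex hull (X - {z})"
    then have "convex hull X = convex hull (X - {z})"
      by (metis assms(2) hull_redundant insert_Diff)
    then show False
      using e extreme_point_of_convex_hull by fastforce
  qed
next
  assume "z \<notin> convex hull (X - {z})"
  then have "z extreme_point_of (convex hull (insert z (X - {z})))"
    using assms by (intro extreme_point_of_convex_hull_insert) auto
  then show "z extreme_point_of (convex hull X)"
    using assms by (simp add: insert_absorb)
qed

text \<open>Give \<open>y\<close> the weight 1 and the opposite neighbour in direction
  \<open>i\<close> the weight \<open>\<bar>y $ i - z $ i\<bar>\<close>. The displacements from
  \<open>z\<close> then cancel.\<close>

lemma in_hull_of_opposite:
  fixes y z :: "real ^ 'n::finite"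
  assumes y: "y \<in> convex hull A"
    and opp: "\<And>i. y $ i \<noteq> z $ i \<Longrightarrow> z - sgn (y $ i - z $ i) *\<^sub>R axis i 1 \<in> A"
  shows "z \<in> convex hull A"
proof (cases "y = z")
  case False
  define d where "d i = y $ i - z $ i" for i
  define D where "D = (\<Sum>i\<in>UNIV. \<bar>d i\<bar>)"
  \<comment> \<open>Where \<open>d i = 0\<close> the weight is 0, and \<open>y\<close> is just some
    point of the hull.\<close>
  define p where "p i = (if d i = 0 then y else z - sgn (d i) *\<^sub>R axis i 1)" for i
  define r where "r = (\<Sum>i\<in>UNIV. (\<bar>d i\<bar> / D) *\<^sub>R p i)"
  obtain k where "y $ k \<noteq> z $ k"
    using False by (auto simp: vec_eq_iff)
  then have "0 < \<bar>d k\<bar>"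
    by (simp add: d_def)
  also have "\<bar>d k\<bar> \<le> D"
    unfolding D_def by (rule member_le_sum) auto
  finally have D: "0 < D" .
  have "p i \<in> convex hull A" for i
    using y opp by (auto simp: p_def d_def hull_inc)
  moreover have "(\<Sum>i\<in>UNIV. \<bar>d i\<bar> / D) = 1"
    using D by (simp add: D_def flip: sum_divide_distrib)
  ultimately have r: "r \<in> convex hull A"
    unfolding r_def using D by (intro convex_sum) auto
  have "\<bar>d i\<bar> *\<^sub>R p i = \<bar>d i\<bar> *\<^sub>R z - (y - z) $ i *\<^sub>R axis i 1" for i
    by (simp add: p_def d_def algebra_simps abs_sgn)
  moreover have "D *\<^sub>R r = (\<Sum>i\<in>UNIV. \<bar>d i\<bar> *\<^sub>R p i)"
    using D by (simp add: r_def scaleR_sum_right)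
  moreover have "(\<Sum>i\<in>UNIV. (y - z) $ i *\<^sub>R axis i 1) = y - z"
    using basis_expansion[of "y - z"] by (simp add: scalar_mult_eq_scaleR)
  ultimately have "D *\<^sub>R r = D *\<^sub>R z - (y - z)"
    by (simp add: sum_subtractf D_def scaleR_sum_left)
  then have "y + D *\<^sub>R r = (1 + D) *\<^sub>R z"
    by (simp add: algebra_simps)
  moreover have "(1 / (1 + D)) *\<^sub>R y + (D / (1 + D)) *\<^sub>R r
      = (1 / (1 + D)) *\<^sub>R (y + D *\<^sub>R r)"
    by (simp add: scaleR_add_right)
  ultimately have "(1 / (1 + D)) *\<^sub>R y + (D / (1 + D)) *\<^sub>R r
      = (1 / (1 + D)) *\<^sub>R ((1 + D) *\<^sub>R z)"
    by simp
  also have "\<dots> = z"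
    using D by simp
  finally show ?thesis
    using mem_convex_alt[OF convex_convex_hull y r, of 1 D] D by simp
qed (use y in simp)

text \<open>Coordinates outside \<open>J\<close> vanish on \<open>X\<close>, so only directions in
  \<open>J\<close> can separate \<open>y\<close> from \<open>z\<close>. The induction is on the
  number of coordinates that do.\<close>

lemma fully_convex_Diff:
  fixes X :: "(real ^ 'n::finite) set"
  assumes fc: "fully_convex X" and z: "z \<in> X" and out: "z \<notin> convex hull (X - {z})"
    and J: "\<And>x j. x \<in> X \<Longrightarrow> j \<notin> J \<Longrightarrow> x $ j = 0"
    and proj: "\<And>i. i \<in> J \<Longrightarrow> z - axis i 1 \<in> X \<or> z + axis i 1 \<in> X
      \<or> fully_convex (omit_coord i ` (X - {z}))"
  shows "fully_convex (X - {z})"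
proof -
  have r: "rounds X"
    using fc by (simp add: fully_convex_iff_rounds)
  have L: "x \<in> int_lattice" if "x \<in> X" for x
    using fc that by (auto simp: fully_convex_def)
  have LI: "x $ j \<in> \<int>" if "x \<in> X" for x j
    using L[OF that] by (simp add: int_lattice_def)
  have sub: "convex hull (X - {z}) \<subseteq> convex hull X"
    by (rule hull_mono) auto
  have "\<exists>x \<in> X - {z}. near x y" if "y \<in> convex hull (X - {z})" for y
    using that
  proof (induction "card {j. y $ j \<noteq> z $ j}" arbitrary: y rule: less_induct)
    case less
    show ?case
    proof (rule ccontr)
      assume none: "\<not> (\<exists>x \<in> X - {z}. near x y)"
      then have nz: "near z y"
        using r less.prems sub unfolding rounds_def by blast
      obtain i where i: "y $ i \<noteq> z $ i" "z - sgn (y $ i - z $ i) *\<^sub>R axis i 1 \<notin> X - {z}"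
        using in_hull_of_opposite[OF less.prems, of z] out by blast
      define s where "s = sgn (y $ i - z $ i)"
      have s: "s = 1 \<or> s = -1"
        using i(1) by (auto simp: s_def sgn_if)
      have s_abs: "s * (y $ i - z $ i) = \<bar>y $ i - z $ i\<bar>"
        by (simp add: s_def abs_sgn mult.commute)
      have yi: "0 < s * (y $ i - z $ i)" "s * (y $ i - z $ i) < 1"
        using nz i(1) by (auto simp: s_abs near_def abs_minus_commute)
      have "z - s *\<^sub>R axis i 1 \<noteq> z" "z + s *\<^sub>R axis i 1 \<noteq> z"
        using s by auto
      \<comment> \<open>The neighbour of \<open>z\<close> on the side of \<open>y\<close> would
        itself round \<open>y\<close>.\<close>
      have "near (z + s *\<^sub>R axis i 1) y"
        using nz yi s by (auto simp: near_def axis_def)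
      then have "z + s *\<^sub>R axis i 1 \<notin> X"
        using none \<open>z + s *\<^sub>R axis i 1 \<noteq> z\<close> by blast
      moreover have "z - s *\<^sub>R axis i 1 \<notin> X"
        using i(2) \<open>z - s *\<^sub>R axis i 1 \<noteq> z\<close> by (auto simp: s_def)
      ultimately have no: "z - axis i 1 \<notin> X" "z + axis i 1 \<notin> X"
        using s by auto
      have "X \<subseteq> {x. x $ j = 0}" if "j \<notin> J" for j
        using J that by blast
      then have "convex hull X \<subseteq> {x. x $ j = 0}" if "j \<notin> J" for j
        using that by (intro hull_minimal) (auto simp: convex_def)
      then have "i \<in> J"
        using i(1) z J less.prems sub by fastforce
      then have "rounds (omit_coord i ` (X - {z}))"
        using proj no by (auto simp: fully_convex_iff_rounds)
      moreover have "omit_coord i y \<in> convex hull (omit_coord i ` (X - {z}))"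
        using less.prems unfolding convex_hull_linear_image[OF linear_omit_coord, symmetric] by blast
      ultimately obtain x where x: "x \<in> X - {z}" "near (omit_coord i x) (omit_coord i y)"
        unfolding rounds_def by blast
      have xn: "\<bar>x $ j - y $ j\<bar> < 1" if "j \<noteq> i" for j
        using x(2)[unfolded near_def, rule_format, of j] that by simp
      \<comment> \<open>\<open>m\<close> and \<open>u\<close> are the offsets of \<open>x\<close>
        and \<open>y\<close> from \<open>z\<close> in direction \<open>i\<close>, positive on the
        side of \<open>y\<close>.\<close>
      define m where "m = s * (x $ i - z $ i)"
      have sm: "x $ i - z $ i = s * m"
        using s by (auto simp: m_def)
      define u where "u = s * (y $ i - z $ i)"
      have su: "y $ i - z $ i = s * u"
        using s by (auto simp: u_def)
      have u: "0 < u" "u < 1"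
        using yi by (simp_all add: u_def)
      \<comment> \<open>\<open>x\<close> is close to \<open>y\<close> in all other coordinates, so
        the failure to round \<open>y\<close> lies in coordinate \<open>i\<close>.\<close>
      have "\<not> \<bar>x $ i - y $ i\<bar> < 1"
        using none x(1) xn unfolding near_def by metis
      moreover have "x $ i - y $ i = s * (m - u)"
        using sm su by (simp add: algebra_simps)
      ultimately have mu: "\<bar>m - u\<bar> \<ge> 1"
        using s by auto
      have xb: "of_int \<lfloor>y $ j\<rfloor> \<le> x $ j \<and> x $ j \<le> of_int \<lceil>y $ j\<rceil>" if "j \<noteq> i" for j
        using int_near_imp_between[of "x $ j" "of_int \<lfloor>y $ j\<rfloor>" "of_int \<lceil>y $ j\<rceil>" "y $ j"]
          xn[OF that] LI x(1) by auto
      have zb: "of_int \<lfloor>y $ j\<rfloor> \<le> z $ j \<and> z $ j \<le> of_int \<lceil>y $ j\<rceil>" for j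
        using near_floor_ceiling[OF L[OF z] nz] .
      have yb: "of_int \<lfloor>y $ j\<rfloor> \<le> y $ j \<and> y $ j \<le> of_int \<lceil>y $ j\<rceil>" for j
        by simp
      have comb: "of_int \<lfloor>y $ j\<rfloor> \<le> (1 - t) * a + t * b \<and> (1 - t) * a + t * b \<le> of_int \<lceil>y $ j\<rceil>"
        if "0 \<le> t" "t \<le> 1" "of_int \<lfloor>y $ j\<rfloor> \<le> a \<and> a \<le> of_int \<lceil>y $ j\<rceil>"
          "of_int \<lfloor>y $ j\<rfloor> \<le> b \<and> b \<le> of_int \<lceil>y $ j\<rceil>" for t a b :: real and j
        using convexD_alt[of "{of_int \<lfloor>y $ j\<rfloor> .. of_int \<lceil>y $ j\<rceil>}" a b t] that by auto
      show False
      proof (cases "m \<ge> u")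
        case True
        then have m1: "m \<ge> 1"
          using mu u by linarith
        \<comment> \<open>The point \<open>w\<close> has offset exactly 1 in direction
          \<open>i\<close>. Its coordinate there is an integer, so a rounding of \<open>w\<close>
          keeps it and differs from \<open>z\<close>.\<close>
        define t where "t = 1 / m"
        have t: "0 \<le> t" "t \<le> 1" "t * m = 1"
          using m1 by (auto simp: t_def)
        define w where "w = (1 - t) *\<^sub>R z + t *\<^sub>R x"
        have "w \<in> convex hull X"
          unfolding w_def using t z x(1)
          by (intro convexD_alt[OF convex_convex_hull]) (auto simp: hull_inc)
        then obtain x' where x': "x' \<in> X" "near x' w"
          using r by (auto simp: rounds_def)
        have "w $ i = z $ i + t * (x $ i - z $ i)"
          by (simp add: w_def algebra_simps)
        also have "\<dots> = z $ i + s"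
          using t by (simp add: sm mult.left_commute)
        finally have wi: "w $ i = z $ i + s" .
        have "w $ i \<in> \<int>"
          using wi s LI[OF z, of i] by auto
        then have "x' $ i = w $ i"
          using int_near_imp_between[of "x' $ i" "w $ i" "w $ i" "w $ i"] x' LI
          by (auto simp: near_def)
        then have "x' \<noteq> z"
          using wi s by auto
        have "near x' y"
        proof (rule near_trans_floor_ceiling[OF L[OF x'(1)] x'(2)])
          fix j
          show "of_int \<lfloor>y $ j\<rfloor> \<le> w $ j \<and> w $ j \<le> of_int \<lceil>y $ j\<rceil>"
          proof (cases "j = i")
            case True
            have "z $ i + s \<in> \<int>"
              using \<open>w $ i \<in> \<int>\<close> wi by simp
            then have "of_int \<lfloor>y $ i\<rfloor> \<le> z $ i + s \<and> z $ i + s \<le> of_int \<lceil>y $ i\<rceil>"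
              using yi s
              by (intro int_near_imp_between[of _ _ _ "y $ i"]) auto
            then show ?thesis using True wi by simp
          next
            case False
            then show ?thesis
              using comb[OF t(1,2) zb[of j] xb[of j]] by (simp add: w_def)
          qed
        qed
        then show False
          using none x'(1) \<open>x' \<noteq> z\<close> by blast
      next
        case False
        then have m0: "m < 0"
          using mu u by linarith
        \<comment> \<open>Now \<open>x\<close> and \<open>y\<close> lie strictly on opposite sides
          of \<open>z\<close> in direction \<open>i\<close>, and \<open>y'\<close> is where their
          segment reaches the coordinate \<open>z $ i\<close>.\<close>
        define t where "t = u / (u - m)"
        have t: "0 \<le> t" "t \<le> 1" "t * (u - m) = u"
          using m0 u by (auto simp: t_def)
        define y' where "y' = (1 - t) *\<^sub>R y + t *\<^sub>R x"
        have y': "y' \<in> convex hull (X - {z})"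
          unfolding y'_def using t x(1) less.prems
          by (intro convexD_alt[OF convex_convex_hull]) (auto simp: hull_inc)
        have "y' $ i - z $ i = (y $ i - z $ i) - t * ((y $ i - z $ i) - (x $ i - z $ i))"
          by (simp add: y'_def algebra_simps)
        also have "\<dots> = s * (u - t * (u - m))"
          by (simp add: sm su algebra_simps)
        finally have y'i: "y' $ i = z $ i"
          using t by simp
        \<comment> \<open>Coordinates where \<open>y\<close> agrees with \<open>z\<close> are
          integers, so \<open>x\<close> agrees there as well and no new difference arises.\<close>
        have "y' $ j = z $ j" if "y $ j = z $ j" for j
        proof (cases "j = i")
          case False
          have "y $ j \<in> \<int>"
            using that LI[OF z] by simp
          then have "x $ j = y $ j"
            using int_near_imp_between[of "x $ j" "y $ j" "y $ j" "y $ j"] xn[OF False] LI x(1)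
            by auto
          then show ?thesis
            using that by (simp add: y'_def algebra_simps)
        qed (use y'i in simp)
        then have "{j. y' $ j \<noteq> z $ j} \<subset> {j. y $ j \<noteq> z $ j}"
          using i(1) y'i by blast
        then have "card {j. y' $ j \<noteq> z $ j} < card {j. y $ j \<noteq> z $ j}"
          by (intro psubset_card_mono) auto
        then obtain x' where x': "x' \<in> X - {z}" "near x' y'"
          using less.hyps y' by blast
        have "near x' y"
        proof (rule near_trans_floor_ceiling[OF _ x'(2)])
          show "x' \<in> int_lattice"
            using x'(1) L by blast
          fix j
          show "of_int \<lfloor>y $ j\<rfloor> \<le> y' $ j \<and> y' $ j \<le> of_int \<lceil>y $ j\<rceil>"
          proof (cases "j = i")
            case True
            then show ?thesis using zb y'i by simp
          next
            case False
            then show ?thesis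
              using comb[OF t(1,2) yb[of j] xb[of j]] by (simp add: y'_def)
          qed
        qed
        then show False
          using none x'(1) by blast
      qed
    qed
  qed
  then show ?thesis
    using L by (auto simp: fully_convex_iff_rounds rounds_def)
qed

section \<open>Peelability by induction on the number of coordinates\<close>

lemma peelable_on_iff_fully_convex:
  fixes X :: "(real ^ 'n::finite) set"
  assumes "finite X" "fully_convex X" "z \<in> X"
    and "\<And>x j. x \<in> X \<Longrightarrow> j \<notin> J \<Longrightarrow> x $ j = 0"
  shows "peelable_on J X z \<longleftrightarrow> fully_convex (X - {z})"
  using assms
proof (induction "card J" arbitrary: J X z rule: less_induct)
  case less
  note fc = less.prems(2) and z = less.prems(3)
  have ext: "z extreme_point_of (convex hull X) \<longleftrightarrow> z \<notin> convex hull (X - {z})"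
    using extreme_point_iff_notin_hull_Diff less.prems by blast
  \<comment> \<open>Over a trivial fibre, deleting \<open>z\<close> commutes with projecting, so the
    induction hypothesis for \<open>J - {i}\<close> applies.\<close>
  have step: "peelable_on (J - {i}) (omit_coord i ` X) (omit_coord i z)
      \<longleftrightarrow> fully_convex (omit_coord i ` (X - {z}))"
    if i: "i \<in> J" and no: "z - axis i 1 \<notin> X" "z + axis i 1 \<notin> X" for i
  proof -
    have "card (J - {i}) < card J"
      using i by (intro psubset_card_mono) auto
    then have "peelable_on (J - {i}) (omit_coord i ` X) (omit_coord i z)
        \<longleftrightarrow> fully_convex (omit_coord i ` X - {omit_coord i z})"
      using less.prems fully_convex_omit_coord by (intro less.hyps) auto
    then show ?thesis
      using omit_coord_image_Diff[OF fc z no] by simp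
  qed
  show ?case
  proof
    assume p: "peelable_on J X z"
    have "z - axis i 1 \<in> X \<or> z + axis i 1 \<in> X \<or> fully_convex (omit_coord i ` (X - {z}))"
      if i: "i \<in> J" for i
    proof (cases "card J \<ge> 2")
      case True
      then show ?thesis
        using p i step by (subst (asm) peelable_on.simps) blast
    next
      \<comment> \<open>The recursion stops at one coordinate. There all of \<open>X\<close>
        projects to 0, so a trivial fibre leaves an empty projection, which is fully convex.\<close>
      case False
      then have "card J = 1"
        using i by (metis One_nat_def card_eq_0_iff finite emptyE less_2_cases not_le)
      then have J: "J = {i}"
        using i by (auto simp: card_Suc_eq)
      show ?thesis
      proof (rule ccontr)
        assume no: "\<not> ?thesis"
        then have "omit_coord i ` (X - {z}) = omit_coord i ` X - {omit_coord i z}"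
          using omit_coord_image_Diff[OF fc z] by blast
        also have "\<dots> = {}"
          using less.prems(3,4) J by (auto simp: vec_eq_iff)
        finally have "omit_coord i ` (X - {z}) = {}" .
        then have "fully_convex (omit_coord i ` (X - {z}))"
          by (simp only: fully_convex_empty)
        with no show False
          by blast
      qed
    qed
    moreover have "z \<notin> convex hull (X - {z})"
      using p ext by (subst (asm) peelable_on.simps) blast
    ultimately show "fully_convex (X - {z})"
      using fully_convex_Diff[OF fc z] less.prems(4) by blast
  next
    assume fc': "fully_convex (X - {z})"
    \<comment> \<open>A fully convex set contains all lattice points of its hull, and
      \<open>z\<close> has been deleted.\<close>
    have "z \<notin> convex hull (X - {z})"
      using fully_convex_lattice_point[OF fc', of z] fc z by (auto simp: fully_convex_def)
    then show "peelable_on J X z"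
      using ext step fully_convex_omit_coord[OF fc'] by (subst peelable_on.simps) blast
  qed
qed

theorem theorem3:
  fixes X :: "(real ^ 'n::finite) set" and z :: "real ^ 'n"
  assumes "X \<subseteq> int_lattice"
    and "X \<noteq> {}"
    and "finite X"
    and "fully_convex X"
    and "z \<in> X"
  shows "peelable X z \<longleftrightarrow> fully_convex (X - {z})"
  unfolding peelable_def using assms by (intro peelable_on_iff_fully_convex) auto

end
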